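(* Let $c=1/(12\pi^2 \mathrm{e})$. There is an absolute constant $C>0$ such that for all integers $n\geq 4$ and $r$ with \[ 1\leq r\leq c\, n(\log n)^{-1}(\log\log n)^{-2}, \] setting $x=x_r(n/r)$, one has \[ P\big(\ell_r(\bar Z)=n\big)=\frac{Q(x)}{\sqrt{2\pi\lambda(x)}}\,(1+\varepsilon_{n,r}),\qquad |\varepsilon_{n,r}|\leq \frac{Cr}{n}. \]
   Context: $\log$ is the natural logarithm. $Z_1,Z_2,\dots$ are independent Poisson random variables with $\mathbf{E}Z_j=1/j$, and $\ell_r(\bar Z)=1Z_1+2Z_2+\cdots+rZ_r$. For an integer $r\geq1$ and real $u\geq 1$, $x_r(u)$ denotes the unique positive solution of $\sum_{j=1}^r x_r(u)^j=ur$. For given $n,r$ and $z>0$, \[ Q(z)=\frac{1}{z^n}\exp\left\{\sum_{j=1}^r\frac{z^j-1}{j}\right\},\qquad \lambda(z)=\sum_{j=1}^r jz^j . \] *)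

theory Defs
  imports "HOL-Probability.Probability"
begin

text \<open>
  A sequence of independent Poisson variables, the \<open>j\<close>-th one of mean \<open>1/j\<close>. The index set starts
  at 1; \<open>Z 0\<close> is unconstrained and never used.
\<close>

definition indep_poisson_seq :: "'a measure \<Rightarrow> (nat \<Rightarrow> 'a \<Rightarrow> nat) \<Rightarrow> bool" where
  "indep_poisson_seq M Z \<longleftrightarrow>
     prob_space M \<and>
     prob_space.indep_vars M (\<lambda>_. count_space UNIV) Z {1..} \<and>
     (\<forall>j\<ge>1. distr M (count_space UNIV) (Z j) = measure_pmf (poisson_pmf (1 / real j)))"

definition ell :: "nat \<Rightarrow> (nat \<Rightarrow> 'a \<Rightarrow> nat) \<Rightarrow> 'a \<Rightarrow> nat" where
  "ell r Z \<omega> = (\<Sum>j=1..r. j * Z j \<omega>)"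

definition saddle :: "nat \<Rightarrow> real \<Rightarrow> real" where
  "saddle r u = (THE x. x > 0 \<and> (\<Sum>j=1..r. x ^ j) = u * real r)"

lemma saddle_ex1:
  fixes u :: real
  assumes "r \<ge> 1" and "u \<ge> 1"
  shows "\<exists>!x. x > 0 \<and> (\<Sum>j=1..r. x ^ j) = u * real r"
proof -
  let ?f = "\<lambda>x::real. \<Sum>j=1..r. x ^ j"
  have mono: "?f x < ?f y" if "0 < x" "x < y" for x y
    using that assms(1) by (intro sum_strict_mono) (auto intro: power_strict_mono)
  have pos: "u * real r \<ge> 0"
    using assms by simp
  have "?f 0 \<le> u * real r"
    using pos by (simp add: power_0_left)
  moreover have "u * real r \<le> ?f (u * real r)"
  proof -
    have "(u * real r) ^ 1 \<le> ?f (u * real r)"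
      by (rule member_le_sum) (use pos assms(1) in auto)
    then show ?thesis by simp
  qed
  moreover have "continuous_on {0..u * real r} ?f"
    by (intro continuous_intros)
  ultimately obtain x where x: "0 \<le> x" "?f x = u * real r"
    using IVT'[of ?f 0 "u * real r" "u * real r"] pos by blast
  have "u * real r > 0"
    using assms by simp
  moreover have "?f 0 = 0"
    by (simp add: power_0_left)
  ultimately have "x \<noteq> 0"
    using x(2) by force
  with x have "x > 0 \<and> ?f x = u * real r"
    by simp
  moreover have "y = x" if "y > 0 \<and> ?f y = u * real r" for y
    using mono[of x y] mono[of y x] that calculation by fastforce
  ultimately show ?thesis
    by blast
qed

definition Q :: "nat \<Rightarrow> nat \<Rightarrow> real \<Rightarrow> real" where
  "Q n r z = 1 / z ^ n * exp (\<Sum>j=1..r. (z ^ j - 1) / real j)"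

definition lam :: "nat \<Rightarrow> real \<Rightarrow> real" where
  "lam r z = (\<Sum>j=1..r. real j * z ^ j)"

end

theory Submission
  imports Defs "HOL-Real_Asymp.Real_Asymp"
begin

text \<open>
  By Cauchy's formula on the circle of radius \<open>x\<close>, the probability is \<open>Q x / (2 \<pi>)\<close> times the integral over
  \<open>[-\<pi>, \<pi>]\<close> of \<open>exp (phase t)\<close>, where the saddle point equation kills the linear term of the phase
  and \<open>\<lambda>\<close> is minus its second derivative at 0.

  On \<open>|t| \<le> \<pi> / r\<close> the phase has real part at most \<open>- \<lambda> t\<^sup>2 / 12\<close>, and expanding to third order gives a
  Gaussian times \<open>1 - i \<mu> t\<^sup>3 / 6\<close>, where \<open>\<mu>\<close> is the sum of
  the \<open>j\<^sup>2 x\<^sup>j\<close>, and the odd part integrates to 0; since \<open>r n / 2 \<le> \<lambda>\<close> and the \<open>k\<close>-th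
  moments of the weights \<open>x\<^sup>j\<close> are at most \<open>r\<^sup>k n\<close>, the relative error is of order \<open>r / n\<close>.

  On \<open>\<pi> / r < |t| \<le> \<pi>\<close> the integrand is at most \<open>n\<^sup>-\<^sup>2\<close>. If \<open>x < 2\<close>, comparing the geometric sums of
  \<open>x\<close> and \<open>x exp (i t)\<close> gives decay \<open>exp (- u / (80 ln\<^sup>2 u))\<close> with \<open>u = n / r\<close>, and the upper bound on \<open>r\<close> makes
  the exponent exceed \<open>2 ln n\<close>. If \<open>x \<ge> 2\<close>, then \<open>r\<close> is at most logarithmic in \<open>n\<close> and the two terms
  \<open>j = r - 1\<close> and \<open>j = r\<close> alone suffice. The finitely many remaining \<open>n\<close> only affect the constant.
\<close>

section \<open>Fourier inversion\<close>

text \<open>The factorial beats every power, so this holds for all complex \<open>w\<close>. Points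
  outside the unit disc are needed because the circle of integration has radius at least 1.\<close>

lemma poisson_pmf_pgf:
  fixes w :: complex
  assumes "a > 0"
  shows "integrable (measure_pmf (poisson_pmf a)) (\<lambda>k. w ^ k)"
    and "(\<integral>k. w ^ k \<partial>measure_pmf (poisson_pmf a)) = exp (of_real a * (w - 1))"
proof -
  let ?f = "\<lambda>k. pmf (poisson_pmf a) k *\<^sub>R w ^ k"
  have f: "?f k = exp (- of_real a) * ((of_real a * w) ^ k /\<^sub>R fact k)" for k
    using assms by (simp add: scaleR_conv_of_real power_mult_distrib field_simps exp_of_real[symmetric])
  have "summable (\<lambda>k. exp (- a) * ((a * norm w) ^ k /\<^sub>R fact k))"
    by (intro summable_mult summable_exp_generic)
  moreover have "norm (?f k) = exp (- a) * ((a * norm w) ^ k /\<^sub>R fact k)" for k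
    using assms by (simp add: norm_power power_mult_distrib field_simps)
  ultimately have int: "integrable (count_space UNIV) ?f"
    by (simp add: integrable_count_space_nat_iff del: pmf_poisson)
  then show "integrable (measure_pmf (poisson_pmf a)) (\<lambda>k. w ^ k)"
    by (subst measure_pmf_eq_density, subst integrable_density) (auto simp del: pmf_poisson)
  have "(\<integral>k. w ^ k \<partial>measure_pmf (poisson_pmf a)) = (\<integral>k. ?f k \<partial>count_space UNIV)"
    by (subst measure_pmf_eq_density, subst integral_density) (auto simp del: pmf_poisson)
  also have "\<dots> = (\<Sum>k. exp (- of_real a) * ((of_real a * w) ^ k /\<^sub>R fact k))"
    using int by (subst integral_count_space_nat) (simp_all only: f)
  also have "\<dots> = exp (- of_real a) * exp (of_real a * w)"
    unfolding exp_def by (intro suminf_mult summable_exp_generic)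
  also have "\<dots> = exp (of_real a * (w - 1))"
    by (simp add: exp_add[symmetric] algebra_simps)
  finally show "(\<integral>k. w ^ k \<partial>measure_pmf (poisson_pmf a)) = exp (of_real a * (w - 1))" .
qed

lemma measurable_ell:
  assumes "indep_poisson_seq M Z"
  shows "ell r Z \<in> measurable M (count_space UNIV)"
proof -
  interpret prob_space M using assms by (simp add: indep_poisson_seq_def)
  have Z: "Z j \<in> measurable M (count_space UNIV)" if "j \<ge> 1" for j
    using assms that by (auto simp: indep_poisson_seq_def indep_vars_def)
  have "(\<lambda>\<omega>. \<Sum>j=1..r. j * Z j \<omega>) \<in> measurable M (count_space UNIV)"
  proof (induction r)
    case (Suc r)
    have "(\<lambda>\<omega>. (\<Sum>j=1..r. j * Z j \<omega>) + Suc r * Z (Suc r) \<omega>) \<in> measurable M (count_space UNIV)"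
      using Suc by (rule measurable_compose_countable[where f = "\<lambda>i \<omega>. i + Suc r * Z (Suc r) \<omega>", rotated])
        (rule measurable_compose[OF Z], auto)
    then show ?case by (simp del: mult_Suc)
  qed simp
  then show ?thesis by (simp add: ell_def[abs_def])
qed

text \<open>\<open>w ^ ell r Z\<close> is the product of the factors \<open>(w ^ j) ^ Z j\<close>,
  so independence reduces the mean to Poisson generating functions at \<open>w ^ j\<close>.\<close>

lemma ell_pgf:
  fixes w :: complex
  assumes "indep_poisson_seq M Z"
  shows "integrable M (\<lambda>\<omega>. w ^ ell r Z \<omega>)"
    and "(\<integral>\<omega>. w ^ ell r Z \<omega> \<partial>M) = exp (\<Sum>j=1..r. (w ^ j - 1) / of_nat j)"
proof -
  interpret prob_space M using assms by (simp add: indep_poisson_seq_def)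
  let ?g = "\<lambda>j k. (w ^ j) ^ k :: complex"
  have ind: "indep_vars (\<lambda>_. count_space UNIV) Z {1..}"
    and distr: "\<And>j. j \<ge> 1 \<Longrightarrow> distr M (count_space UNIV) (Z j) = measure_pmf (poisson_pmf (1 / real j))"
    using assms by (auto simp: indep_poisson_seq_def)
  have Z: "Z j \<in> measurable M (count_space UNIV)" if "j \<ge> 1" for j
    using ind that by (auto simp: indep_vars_def)
  have indw: "indep_vars (\<lambda>_. borel) (\<lambda>j \<omega>. ?g j (Z j \<omega>)) {1..r}"
    by (rule indep_vars_compose2[OF indep_vars_subset[OF ind]]) auto
  have int: "integrable M (\<lambda>\<omega>. ?g j (Z j \<omega>))"
    and E: "(\<integral>\<omega>. ?g j (Z j \<omega>) \<partial>M) = exp ((w ^ j - 1) / of_nat j)" if "j \<in> {1..r}" for j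
  proof -
    have j: "j \<ge> 1" using that by simp
    show "integrable M (\<lambda>\<omega>. ?g j (Z j \<omega>))"
      using poisson_pmf_pgf(1)[of "1 / real j" "w ^ j"] j distr[OF j] Z[OF j]
      by (subst integrable_distr_eq[symmetric, of "Z j" M "count_space UNIV"]) auto
    show "(\<integral>\<omega>. ?g j (Z j \<omega>) \<partial>M) = exp ((w ^ j - 1) / of_nat j)"
      using poisson_pmf_pgf(2)[of "1 / real j" "w ^ j"] j distr[OF j] Z[OF j]
      by (subst integral_distr[symmetric, of "Z j" M "count_space UNIV"]) auto
  qed
  have eq: "w ^ ell r Z \<omega> = (\<Prod>j\<in>{1..r}. ?g j (Z j \<omega>))" for \<omega>
    by (simp add: ell_def power_sum power_mult)
  show "integrable M (\<lambda>\<omega>. w ^ ell r Z \<omega>)"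
    unfolding eq using int by (intro indep_vars_integrable indw) auto
  have "(\<integral>\<omega>. w ^ ell r Z \<omega> \<partial>M) = (\<Prod>j\<in>{1..r}. \<integral>\<omega>. ?g j (Z j \<omega>) \<partial>M)"
    unfolding eq using int by (intro indep_vars_lebesgue_integral indw) auto
  also have "\<dots> = exp (\<Sum>j=1..r. (w ^ j - 1) / of_nat j)"
    by (simp add: exp_sum E)
  finally show "(\<integral>\<omega>. w ^ ell r Z \<omega> \<partial>M) = exp (\<Sum>j=1..r. (w ^ j - 1) / of_nat j)" .
qed

lemma integral_cis_period:
  fixes k :: int
  shows "(\<integral>t. indicator {-pi..pi} t *\<^sub>R cis (of_int k * t) \<partial>lborel) = (if k = 0 then 2 * of_real pi else 0)"
proof (cases "k = 0")
  case True
  then show ?thesis by (simp add: scaleR_conv_of_real)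
next
  case False
  let ?F = "\<lambda>t. cis (of_int k * t) / (\<i> * of_int k)"
  have d: "(?F has_vector_derivative cis (of_int k * t)) (at t within {-pi..pi})" for t
  proof -
    note exp_scaleR_has_vector_derivative_right[of "\<i> * of_int k" t "{-pi..pi}"]
    from has_vector_derivative_divide[OF this, of "\<i> * of_int k"] show ?thesis
      using False by (simp add: cis_conv_exp scaleR_conv_of_real mult_ac)
  qed
  have "(\<integral>t. indicator {-pi..pi} t *\<^sub>R cis (of_int k * t) \<partial>lborel) = ?F pi - ?F (-pi)"
    by (rule integral_FTC_Icc[OF _ d]) (auto intro!: continuous_intros)
  also have "?F pi = ?F (-pi)"
    by (intro arg_cong2[of _ _ _ _ divide]) (simp_all add: complex_eq_iff sin_zero_iff_int2)
  finally show ?thesis using False by simp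
qed

text \<open>Cauchy's coefficient formula without contour integrals: after Fubini, orthogonality of
  the characters over a full period keeps only the event that \<open>ell r Z\<close> equals
  \<open>n\<close>.\<close>

lemma ell_coefficient:
  fixes x :: real
  assumes "indep_poisson_seq M Z" "x > 0"
  shows "of_real (2 * pi * x ^ n * measure M {\<omega> \<in> space M. ell r Z \<omega> = n}) =
    (\<integral>t. indicator {-pi..pi} t *\<^sub>R
       (exp (\<Sum>j=1..r. ((of_real x * cis t) ^ j - 1) / of_nat j) * cis (- (real n * t))) \<partial>lborel)"
proof -
  interpret prob_space M using assms by (simp add: indep_poisson_seq_def)
  interpret pair_sigma_finite lborel M ..
  note [measurable] = measurable_ell[OF assms(1), of r]
  let ?X = "ell r Z"
  let ?f = "\<lambda>t \<omega>. indicator {-pi..pi} t *\<^sub>R (of_real (x ^ ?X \<omega>) * cis ((real (?X \<omega>) - real n) * t))"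
  have m: "(\<lambda>(t, \<omega>). ?f t \<omega>) \<in> borel_measurable (lborel \<Otimes>\<^sub>M M)"
    unfolding cis_conv_exp by measurable
  \<comment> \<open>On the circle the integrand has modulus \<open>x ^ ell r Z\<close>, so the
    generating function at the real point \<open>x\<close> supplies the majorant for Fubini.\<close>
  have xint: "integrable M (\<lambda>\<omega>. x ^ ?X \<omega>)"
    using integrable_norm[OF ell_pgf(1)[OF assms(1), of "of_real x" r]] assms(2) by (simp add: norm_power)
  have n: "norm (?f t \<omega>) = indicator {-pi..pi} t * x ^ ?X \<omega>" for t \<omega>
    using assms(2) by (simp add: norm_mult norm_power)
  have int: "integrable (lborel \<Otimes>\<^sub>M M) (\<lambda>(t, \<omega>). ?f t \<omega>)"
  proof (rule Fubini_integrable[OF m])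
    show "integrable lborel (\<lambda>t. \<integral>\<omega>. norm (case (t, \<omega>) of (t, \<omega>) \<Rightarrow> ?f t \<omega>) \<partial>M)"
      by (simp only: prod.case n) simp
    have "integrable M (\<lambda>\<omega>. ?f t \<omega>)" for t
      using n xint unfolding cis_conv_exp
      by (intro Bochner_Integration.integrable_bound[OF xint]) 
        (auto simp: indicator_def norm_mult norm_power assms(2) less_imp_le)
    then show "AE t in lborel. integrable M (\<lambda>\<omega>. case (t, \<omega>) of (t, \<omega>) \<Rightarrow> ?f t \<omega>)"
      by simp
  qed
  have f: "?f t \<omega> = indicator {-pi..pi} t *\<^sub>R ((of_real x * cis t) ^ ?X \<omega> * cis (- (real n * t)))" for t \<omega>
  proof -
    have "cis ((real (?X \<omega>) - real n) * t) = cis t ^ ?X \<omega> * cis (- (real n * t))"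
      by (simp only: Complex.DeMoivre cis_mult) (simp add: algebra_simps)
    then show ?thesis by (simp add: power_mult_distrib)
  qed
  have "(\<integral>t. (\<integral>\<omega>. ?f t \<omega> \<partial>M) \<partial>lborel) = (\<integral>\<omega>. (\<integral>t. ?f t \<omega> \<partial>lborel) \<partial>M)"
    using Fubini_integral[OF int] by simp
  also have "\<dots> = (\<integral>\<omega>. indicator {\<omega> \<in> space M. ?X \<omega> = n} \<omega> *\<^sub>R of_real (2 * pi * x ^ n) \<partial>M)"
  proof (rule Bochner_Integration.integral_cong[OF refl])
    fix \<omega> assume "\<omega> \<in> space M"
    have "(\<integral>t. ?f t \<omega> \<partial>lborel) =
        of_real (x ^ ?X \<omega>) * (\<integral>t. indicator {-pi..pi} t *\<^sub>R cis (of_int (int (?X \<omega>) - int n) * t) \<partial>lborel)"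
      by (subst integral_mult_right_zero[symmetric]) (simp add: algebra_simps)
    then show "(\<integral>t. ?f t \<omega> \<partial>lborel) = indicator {\<omega> \<in> space M. ?X \<omega> = n} \<omega> *\<^sub>R of_real (2 * pi * x ^ n)"
      using \<open>\<omega> \<in> space M\<close> by (simp only: integral_cis_period) (auto simp: indicator_def)
  qed
  also have "\<dots> = of_real (2 * pi * x ^ n * measure M {\<omega> \<in> space M. ?X \<omega> = n})"
    by (simp add: scaleR_conv_of_real)
  finally show ?thesis
    unfolding f by (simp add: ell_pgf(2)[OF assms(1)])
qed

section \<open>The central arc\<close>

text \<open>The upper bound is the half-angle formula. For the lower one, Taylor's formula gives
  \<open>y^2 / 2 - y^4 / 24\<close>, and \<open>y^2 \<le> 10\<close> leaves the factor
  \<open>1/2 - 10/24 = 1/12\<close>.\<close>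

lemma cos_quadratic_bounds:
  fixes y :: real
  shows "1 - cos y \<le> y\<^sup>2 / 2" and "\<bar>y\<bar> \<le> pi \<Longrightarrow> y\<^sup>2 / 12 \<le> 1 - cos y"
proof -
  have "cmod (iexp y - (\<Sum>k\<le>3. (\<i> * y) ^ k / fact k)) \<le> \<bar>y\<bar> ^ 4 / fact 4"
    using iexp_approx1[of y 3] by (simp add: numeral_eq_Suc)
  moreover have "\<bar>Re (iexp y - (\<Sum>k\<le>3. (\<i> * y) ^ k / fact k))\<bar> \<le> cmod (iexp y - (\<Sum>k\<le>3. (\<i> * y) ^ k / fact k))"
    by (rule abs_Re_le_cmod)
  moreover have "Re (iexp y - (\<Sum>k\<le>3. (\<i> * y) ^ k / fact k)) = cos y - 1 + y\<^sup>2 / 2"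
    by (simp add: numeral_eq_Suc Re_exp Re_power2 field_simps)
  ultimately have *: "cos y - 1 + y\<^sup>2 / 2 \<le> y ^ 4 / 24"
    by (simp add: fact_numeral)
  show "1 - cos y \<le> y\<^sup>2 / 2"
    using cos_double_sin[of "y / 2"] abs_sin_le_one[of "y/2"] abs_sin_x_le_abs_x[of "y / 2"]
      power_mono[of "\<bar>sin (y / 2)\<bar>" "\<bar>y / 2\<bar>" 2]
    by (simp add: power_divide)
  assume "\<bar>y\<bar> \<le> pi"
  then have "y\<^sup>2 \<le> pi\<^sup>2"
    using power_mono[of "\<bar>y\<bar>" pi 2] by simp
  also have "pi\<^sup>2 \<le> 3.15\<^sup>2"
    using pi_approx by (intro power_mono) auto
  finally have "y\<^sup>2 \<le> 10"
    by (simp add: power2_eq_square)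
  then have "y\<^sup>2 * y\<^sup>2 \<le> 10 * y\<^sup>2"
    by (intro mult_right_mono) auto
  then show "y\<^sup>2 / 12 \<le> 1 - cos y"
    using * by (simp add: power2_eq_square power4_eq_xxxx)
qed

lemma gaussian_integral:
  fixes b :: real
  assumes "b > 0"
  shows "integrable lborel (\<lambda>t. exp (- (b * t\<^sup>2)))"
    and "(\<integral>t. exp (- (b * t\<^sup>2)) \<partial>lborel) = sqrt (pi / b)"
proof -
  define \<sigma> where "\<sigma> = sqrt (1 / (2 * b))"
  have \<sigma>: "\<sigma> > 0" and \<sigma>2: "\<sigma>\<^sup>2 = 1 / (2 * b)"
    using assms by (auto simp: \<sigma>_def)
  have eq: "exp (- (b * t\<^sup>2)) = sqrt (pi / b) * normal_density 0 \<sigma> t" for t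
    using assms by (simp add: normal_density_def \<sigma>2 field_simps)
  show "integrable lborel (\<lambda>t. exp (- (b * t\<^sup>2)))"
    unfolding eq using integrable_normal_density[OF \<sigma>, of 0] by simp
  show "(\<integral>t. exp (- (b * t\<^sup>2)) \<partial>lborel) = sqrt (pi / b)"
    unfolding eq using integral_normal_density[OF \<sigma>, of 0] by simp
qed

text \<open>A single term of the exponential series; it serves to trade powers of \<open>y\<close>
  for part of an exponential decay.\<close>

lemma exp_ge_power_fact:
  fixes y :: real
  assumes "y \<ge> 0"
  shows "y ^ k / fact k \<le> exp y"
proof -
  have "(\<Sum>i\<in>{k}. y ^ i /\<^sub>R fact i) \<le> (\<Sum>i. y ^ i /\<^sub>R fact i)"
    using assms by (intro sum_le_suminf summable_exp_generic) auto
  then show ?thesis by (simp add: exp_def divide_inverse mult.commute)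
qed

text \<open>\<open>x\<close> stands for the saddle point at \<open>u = n / r\<close>. The condition
  \<open>1 \<le> x\<close> corresponds to \<open>r \<le> n\<close> and makes the weights
  \<open>x ^ j\<close> nondecreasing in \<open>j\<close>.\<close>

locale saddle_eq =
  fixes r n :: nat and x :: real
  assumes r_ge_1: "1 \<le> r" and x_ge_1: "1 \<le> x" and sum_eq: "(\<Sum>j=1..r. x ^ j) = real n"
begin

text \<open>\<open>exp (phase t)\<close> is the integrand of the coefficient formula divided by its
  value at 0. It is the characteristic function of \<open>ell r Z - n\<close> under the law
  reweighted by \<open>x ^ ell r Z\<close>, for which \<open>ell r Z\<close> has mean
  \<open>n\<close> and variance \<open>lam r x\<close>.\<close>

definition phase :: "real \<Rightarrow> complex" where
  "phase t = (\<Sum>j=1..r. of_real (x ^ j / real j) * (cis (real j * t) - 1)) - \<i> * of_real (real n * t)"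

lemma x_pos: "0 < x" using x_ge_1 by simp

lemma n_ge_r: "r \<le> n"
proof -
  have "real r = (\<Sum>j=1..r. 1)" by simp
  also have "\<dots> \<le> (\<Sum>j=1..r. x ^ j)"
    using x_ge_1 by (intro sum_mono) (auto intro: one_le_power)
  finally show ?thesis unfolding sum_eq by simp
qed

lemma n_pos: "0 < n" using n_ge_r r_ge_1 by simp

text \<open>Chebyshev's sum inequality for the similarly ordered sequences \<open>j\<close> and
  \<open>x ^ j\<close>, by induction on the number of terms.\<close>

lemma lam_ge: "real r * real n / 2 \<le> lam r x"
proof -
  have "real m * (\<Sum>j=1..m. x ^ j) \<le> 2 * (\<Sum>j=1..m. real j * x ^ j)" for m
  proof (induction m)
    case (Suc m)
    have "(\<Sum>j=1..m. x ^ j) \<le> (\<Sum>j=1..m. x ^ Suc m)"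
      using x_ge_1 by (intro sum_mono power_increasing) auto
    then have "(\<Sum>j=1..m. x ^ j) \<le> real m * x ^ Suc m"
      by simp
    moreover have "0 \<le> x ^ Suc m" using x_pos by simp
    ultimately show ?case
      using Suc by (simp add: algebra_simps del: power_Suc)
  qed simp
  from this[of r] show ?thesis
    unfolding lam_def sum_eq by simp
qed

lemma lam_le: "lam r x \<le> real r * real n"
  unfolding lam_def sum_eq[symmetric] sum_distrib_left
  using x_pos by (intro sum_mono mult_right_mono) auto

lemma lam_pos: "0 < lam r x"
  using lam_ge r_ge_1 n_pos by (smt (verit) divide_pos_pos mult_pos_pos of_nat_0_less_iff less_le_trans zero_less_one not_less_eq_eq One_nat_def)

lemma sum_moment_le:
  "(\<Sum>j=1..r. x ^ j * real j ^ k) \<le> real r ^ k * real n"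
  unfolding sum_eq[symmetric] sum_distrib_left
  using x_pos by (intro sum_mono) (auto simp: mult.commute intro!: mult_right_mono power_mono)

lemma Re_phase: "Re (phase t) = - (\<Sum>j=1..r. x ^ j / real j * (1 - cos (real j * t)))"
  by (simp add: phase_def sum_negf[symmetric] right_diff_distrib minus_diff_eq)

text \<open>Lifts a Taylor remainder for one exponential to the weighted sum. The divisor
  \<open>j\<close> in the weight absorbs one power, so order \<open>k + 1\<close> costs only the
  \<open>k\<close>-th moment.\<close>

lemma norm_sum_remainder:
  assumes "\<And>y. cmod (T y) \<le> \<bar>y\<bar> ^ Suc k / c" "c > 0"
  shows "cmod (\<Sum>j=1..r. of_real (x ^ j / real j) * T (real j * t)) \<le> real r ^ k * real n * \<bar>t\<bar> ^ Suc k / c"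
proof -
  have "cmod (\<Sum>j=1..r. of_real (x ^ j / real j) * T (real j * t))
      \<le> (\<Sum>j=1..r. x ^ j * real j ^ k * (\<bar>t\<bar> ^ Suc k / c))"
  proof (rule sum_norm_le)
    fix j assume j: "j \<in> {1..r}"
    have "cmod (of_real (x ^ j / real j) * T (real j * t)) = x ^ j / real j * cmod (T (real j * t))"
      using x_pos by (simp add: norm_mult norm_divide norm_power)
    also have "\<dots> \<le> x ^ j / real j * (\<bar>real j * t\<bar> ^ Suc k / c)"
      using x_pos by (intro mult_left_mono assms) auto
    also have "\<dots> = x ^ j * real j ^ k * (\<bar>t\<bar> ^ Suc k / c)"
      using j by (simp add: abs_mult power_mult_distrib)
    finally show "cmod (of_real (x ^ j / real j) * T (real j * t)) \<le> x ^ j * real j ^ k * (\<bar>t\<bar> ^ Suc k / c)" .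
  qed
  also have "\<dots> \<le> real r ^ k * real n * (\<bar>t\<bar> ^ Suc k / c)"
    unfolding sum_distrib_right[symmetric] using assms(2) by (intro mult_right_mono sum_moment_le) auto
  finally show ?thesis by simp
qed

text \<open>The third cumulant of the reweighted law, that is, the number \<mu> of the
  overview.\<close>

definition third :: real where "third = (\<Sum>j=1..r. x ^ j * real j ^ 2)"

text \<open>Termwise Taylor expansion of \<open>cis\<close>; by \<open>sum_eq\<close> the linear
  terms add up to \<open>\<i> n t\<close>, which \<open>phase\<close> subtracts. The cruder bound
  will be squared, the finer one is used linearly.\<close>

lemma phase_expansion:
  shows "cmod (phase t + of_real (lam r x * t\<^sup>2 / 2)) \<le> real r ^ 2 * real n * \<bar>t\<bar> ^ 3 / 6"
    and "cmod (phase t + of_real (lam r x * t\<^sup>2 / 2) + \<i> * of_real (third * t ^ 3 / 6)) \<le> real r ^ 3 * real n * t ^ 4 / 24"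
proof -
  let ?T2 = "\<lambda>y::real. cis y - 1 - \<i> * of_real y + of_real (y\<^sup>2 / 2)"
  let ?T3 = "\<lambda>y::real. ?T2 y + \<i> * of_real (y ^ 3 / 6)"
  have 2: "cmod (?T2 y) \<le> \<bar>y\<bar> ^ Suc 2 / 6" for y
    using iexp_approx1[of y 2] by (simp add: numeral_eq_Suc cis_conv_exp algebra_simps)
  have 3: "cmod (?T3 y) \<le> \<bar>y\<bar> ^ Suc 3 / 24" for y
    using iexp_approx1[of y 3] by (simp add: numeral_eq_Suc cis_conv_exp algebra_simps)
  have "(\<Sum>j=1..r. of_real (x ^ j / real j) * ?T2 (real j * t)) =
      (\<Sum>j=1..r. of_real (x ^ j / real j) * (cis (real j * t) - 1)) -
      \<i> * of_real (t * (\<Sum>j=1..r. x ^ j)) + of_real (lam r x * t\<^sup>2 / 2)"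
    unfolding lam_def sum_distrib_left sum_distrib_right sum_divide_distrib of_real_sum
      sum.distrib[symmetric] sum_subtractf[symmetric]
    by (intro sum.cong refl) (simp add: power2_eq_square field_simps)
  then have p2: "phase t + of_real (lam r x * t\<^sup>2 / 2) = (\<Sum>j=1..r. of_real (x ^ j / real j) * ?T2 (real j * t))"
    unfolding sum_eq by (simp only: phase_def mult.commute[of "real n"])
  have "\<i> * of_real (third * t ^ 3 / 6) = (\<Sum>j=1..r. of_real (x ^ j / real j) * (\<i> * of_real ((real j * t) ^ 3 / 6)))"
    unfolding third_def sum_distrib_left sum_distrib_right sum_divide_distrib of_real_sum
    by (intro sum.cong refl) (simp add: power2_eq_square power3_eq_cube field_simps)
  then have p3: "phase t + of_real (lam r x * t\<^sup>2 / 2) + \<i> * of_real (third * t ^ 3 / 6) =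
      (\<Sum>j=1..r. of_real (x ^ j / real j) * ?T3 (real j * t))"
    unfolding p2 by (simp only: sum.distrib[symmetric] distrib_left)
  show "cmod (phase t + of_real (lam r x * t\<^sup>2 / 2)) \<le> real r ^ 2 * real n * \<bar>t\<bar> ^ 3 / 6"
    unfolding p2 using norm_sum_remainder[OF 2] by (simp add: eval_nat_numeral)
  show "cmod (phase t + of_real (lam r x * t\<^sup>2 / 2) + \<i> * of_real (third * t ^ 3 / 6)) \<le> real r ^ 3 * real n * t ^ 4 / 24"
    unfolding p3 using norm_sum_remainder[OF 3, of t] by (simp add: eval_nat_numeral)
qed

text \<open>Termwise cosine bounds. The second needs \<open>j t\<close> in \<open>[-pi, pi]\<close>
  for every \<open>j \<le> r\<close>, which dictates the width \<open>pi / r\<close> of the central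
  arc.\<close>

lemma Re_phase_bounds:
  shows "- (lam r x * t\<^sup>2 / 2) \<le> Re (phase t)"
    and "\<bar>t\<bar> \<le> pi / real r \<Longrightarrow> Re (phase t) \<le> - (lam r x * t\<^sup>2 / 12)"
proof -
  have eq: "(\<Sum>j=1..r. x ^ j / real j * ((real j * t)\<^sup>2 / c)) = lam r x * t\<^sup>2 / c" for c
    unfolding lam_def sum_distrib_right sum_divide_distrib
    by (intro sum.cong refl) (simp add: power2_eq_square)
  have "(\<Sum>j=1..r. x ^ j / real j * (1 - cos (real j * t))) \<le> (\<Sum>j=1..r. x ^ j / real j * ((real j * t)\<^sup>2 / 2))"
    using x_pos by (intro sum_mono mult_left_mono cos_quadratic_bounds) auto
  then show "- (lam r x * t\<^sup>2 / 2) \<le> Re (phase t)"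
    unfolding eq Re_phase by simp
  assume t: "\<bar>t\<bar> \<le> pi / real r"
  have "(\<Sum>j=1..r. x ^ j / real j * ((real j * t)\<^sup>2 / 12)) \<le> (\<Sum>j=1..r. x ^ j / real j * (1 - cos (real j * t)))"
  proof (intro sum_mono mult_left_mono cos_quadratic_bounds)
    fix j assume "j \<in> {1..r}"
    then have "\<bar>real j * t\<bar> \<le> real r * (pi / real r)"
      unfolding abs_mult using t by (intro mult_mono) auto
    then show "\<bar>real j * t\<bar> \<le> pi" using r_ge_1 by simp
  qed (use x_pos in auto)
  then show "Re (phase t) \<le> - (lam r x * t\<^sup>2 / 12)"
    unfolding eq Re_phase by simp
qed

text \<open>With \<open>B\<close> the deviation of the phase from its quadratic part,
  \<open>exp B\<close> is \<open>1 + B\<close> up to \<open>exp (Re B)\<close> times the square of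
  \<open>cmod B\<close>, and \<open>B\<close> is \<open>- D\<close> up to fourth order. The factor
  \<open>exp (Re B)\<close> is harmless, as it recombines with \<open>e\<close> into
  \<open>exp (Re (phase t))\<close>.\<close>

lemma major_arc:
  assumes t: "\<bar>t\<bar> \<le> pi / real r"
  shows "cmod (exp (phase t) - of_real (exp (- (lam r x * t\<^sup>2 / 2))) * (1 - \<i> * of_real (third * t ^ 3 / 6)))
    \<le> 20000 * (real r / real n) * exp (- (lam r x / 24 * t\<^sup>2))"
proof -
  let ?L = "lam r x"
  define B where "B = phase t + of_real (?L * t\<^sup>2 / 2)"
  define D where "D = \<i> * of_real (third * t ^ 3 / 6)"
  define e where "e = exp (- (?L * t\<^sup>2 / 2))"
  \<comment> \<open>The available decay is \<open>exp (- (2 * y))\<close>; one factor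
    \<open>exp y\<close> will pay for powers of \<open>y\<close>, leaving
    \<open>exp (- y)\<close>.\<close>
  define y where "y = ?L * t\<^sup>2 / 24"
  have y: "y \<ge> 0" using lam_pos by (simp add: y_def)
  have ReB: "0 \<le> Re B" using Re_phase_bounds(1)[of t] by (simp add: B_def)
  have eB: "exp (phase t) = of_real e * exp B"
    by (simp add: e_def B_def exp_of_real[symmetric] exp_add[symmetric])
  have "cmod (exp B - (\<Sum>k\<le>1. B ^ k / fact k)) \<le> exp \<bar>Re B\<bar> * cmod B ^ Suc 1 / fact 1"
    by (rule Taylor_exp)
  then have 1: "cmod (exp B - (1 + B)) \<le> exp (Re B) * cmod B ^ 2"
    using ReB by (simp add: numeral_2_eq_2)
  have "e * exp (Re B) = exp (Re (phase t))"
    by (simp add: e_def B_def exp_add[symmetric])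
  also have "\<dots> \<le> exp (- (2 * y))"
    using Re_phase_bounds(2)[OF t] by (simp add: y_def)
  finally have eR: "e * exp (Re B) \<le> exp (- (2 * y))" .
  have ey: "e \<le> exp (- (2 * y))"
    using lam_pos by (simp add: e_def y_def)
  have "cmod (exp (phase t) - of_real e * (1 - D))
      = cmod (of_real e * (exp B - (1 + B)) + of_real e * (B + D))"
    unfolding eB by (simp add: algebra_simps)
  also have "\<dots> \<le> e * cmod (exp B - (1 + B)) + e * cmod (B + D)"
    by (rule order_trans[OF norm_triangle_ineq]) (simp add: norm_mult e_def)
  also have "\<dots> \<le> e * (exp (Re B) * (real r ^ 2 * real n * \<bar>t\<bar> ^ 3 / 6) ^ 2) + e * (real r ^ 3 * real n * t ^ 4 / 24)"
    using phase_expansion[of t] unfolding B_def[symmetric] D_def[symmetric]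
    by (intro add_mono mult_left_mono order_trans[OF 1] power_mono) (auto simp: e_def)
  also have "\<dots> \<le> exp (- (2 * y)) * (real r ^ 2 * real n * \<bar>t\<bar> ^ 3 / 6) ^ 2 + exp (- (2 * y)) * (real r ^ 3 * real n * t ^ 4 / 24)"
    unfolding mult.assoc[symmetric] using eR ey by (intro add_mono mult_right_mono) auto
  \<comment> \<open>Substituting \<open>t^2 = 24 y / lam r x\<close> gives
    \<open>24^3 / 36 = 384\<close> and \<open>24^2 / 24 = 24\<close>.\<close>
  also have "\<dots> = exp (- (2 * y)) * (384 * real r ^ 4 * real n ^ 2 / ?L ^ 3 * y ^ 3 + 24 * real r ^ 3 * real n / ?L ^ 2 * y ^ 2)"
    using lam_pos unfolding y_def by (simp add: field_simps power_mult_distrib power_divide eval_nat_numeral abs_mult)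
  \<comment> \<open>With \<open>lam_ge\<close> both terms become multiples of \<open>r / n\<close>;
    the constants are \<open>384 * 8 * 6 + 24 * 4 * 2 = 18624\<close>.\<close>
  also have "\<dots> \<le> exp (- (2 * y)) * (384 * real r ^ 4 * real n ^ 2 / (real r * real n / 2) ^ 3 * (6 * exp y) + 24 * real r ^ 3 * real n / (real r * real n / 2) ^ 2 * (2 * exp y))"
    using exp_ge_power_fact[OF y, of 3] exp_ge_power_fact[OF y, of 2] lam_ge lam_pos r_ge_1 n_pos y
    by (intro mult_left_mono add_mono mult_mono divide_left_mono power_mono mult_pos_pos zero_less_power) (auto simp: eval_nat_numeral)
  also have "\<dots> = 18624 * (real r / real n) * (exp (- (2 * y)) * exp y)"
    using r_ge_1 n_pos by (simp add: field_simps eval_nat_numeral)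
  also have "exp (- (2 * y)) * exp y = exp (- y)"
    by (simp add: exp_add[symmetric])
  also have "18624 * (real r / real n) * exp (- y) \<le> 20000 * (real r / real n) * exp (- y)"
    by (intro mult_right_mono) auto
  finally show ?thesis unfolding e_def D_def y_def by simp
qed

text \<open>Off the central arc \<open>lam r x * t^2\<close> is at least \<open>9 n / (2 r)\<close>.
  Part of the exponent is kept, and a third of this quantity is spent on the factor
  \<open>r / n\<close>.\<close>

lemma gaussian_tail:
  assumes t: "\<bar>t\<bar> > pi / real r"
  shows "exp (- (lam r x * t\<^sup>2 / 2)) \<le> real r / real n * exp (- (lam r x / 24 * t\<^sup>2))"
proof -
  define y where "y = lam r x * t\<^sup>2"
  have "(3 / real r)\<^sup>2 \<le> \<bar>t\<bar>\<^sup>2"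
    using t r_ge_1 pi_gt3 by (intro power_mono) (auto simp: field_simps intro: order_trans[of _ "pi / real r"])
  then have "real r * real n / 2 * (3 / real r)\<^sup>2 \<le> y"
    unfolding y_def using lam_ge lam_pos by (intro mult_mono) auto
  then have y: "9 / 2 * real n / real r \<le> y"
    using r_ge_1 by (simp add: power2_eq_square field_simps)
  have y0: "y > 0"
    by (rule less_le_trans[OF _ y]) (use r_ge_1 n_pos in simp)
  have "exp (- (y / 2)) \<le> exp (- (y / 24)) * exp (- (y / 3))"
    using y0 by (simp add: exp_add[symmetric])
  also have "exp (- (y / 3)) \<le> 3 / y"
    using exp_ge_power_fact[of "y / 3" 1] y0 by (simp add: exp_minus field_simps)
  also have "3 / y \<le> 3 / (9 / 2 * real n / real r)"
    using y y0 r_ge_1 n_pos by (intro divide_left_mono) auto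
  also have "\<dots> \<le> real r / real n"
    using n_pos by (simp add: field_simps)
  finally show ?thesis by (simp add: y_def mult.commute)
qed

end

section \<open>The minor arcs\<close>

text \<open>If two points of the unit circle are close to 1, so is their quotient. The nonnegative
  quantity is the squared modulus of \<open>2 - cis a - cis b\<close>.\<close>

lemma one_minus_cos_diff_le:
  fixes a b :: real
  shows "1 - cos (a - b) \<le> 2 * (1 - cos a) + 2 * (1 - cos b)"
proof -
  have "0 \<le> (2 - cos a - cos b)\<^sup>2 + (sin a + sin b)\<^sup>2" by simp
  also have "\<dots> = 6 - 4 * cos a - 4 * cos b + 2 * cos (a - b)"
    using sin_cos_squared_add[of a] sin_cos_squared_add[of b]
    unfolding cos_diff by algebra
  finally show ?thesis by simp
qed

lemma geometric_sum_from_1: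
  fixes z :: "'a::comm_ring_1"
  shows "(z - 1) * (\<Sum>j=1..m. z ^ j) = z ^ Suc m - z"
  by (induction m) (auto simp: algebra_simps)

section \<open>Size of \<open>x\<close>, and decay of the integrand on the minor arcs\<close>

context saddle_eq
begin

lemma power_le_n: "x ^ r \<le> real n"
  unfolding sum_eq[symmetric] using r_ge_1 x_pos by (intro member_le_sum) auto

lemma n_le_power: "real n \<le> real r * x ^ r"
proof -
  have "real n \<le> (\<Sum>j=1..r. x ^ r)"
    unfolding sum_eq[symmetric] using x_ge_1 by (intro sum_mono power_increasing) auto
  then show ?thesis by simp
qed

text \<open>
  The tangent line of \<open>exp\<close> at the mean exponent \<open>(r + 1) / 2\<close> bounds the sum of the powers below.
\<close>

lemma r_ln_x_le: "real r * ln x \<le> 2 * ln (real n / real r)"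
proof -
  define m where "m = (real r + 1) / 2"
  define w where "w = ln x"
  have w: "w \<ge> 0" using x_ge_1 by (simp add: w_def)
  have "(\<Sum>j=1..r. real j) = real r * m"
    unfolding m_def by (induction r) (auto simp: field_simps)
  then have "real r * exp (m * w) = (\<Sum>j=1..r. exp (m * w) * (1 + (real j - m) * w))"
    by (simp add: sum_distrib_left[symmetric] sum_distrib_right[symmetric] sum.distrib sum_subtractf)
  also have "\<dots> \<le> (\<Sum>j=1..r. x ^ j)"
  proof (rule sum_mono)
    fix j
    have "exp (m * w) * (1 + (real j - m) * w) \<le> exp (m * w) * exp ((real j - m) * w)"
      by (intro mult_left_mono exp_ge_add_one_self) auto
    also have "\<dots> = exp (real j * w)"
      by (simp add: exp_add[symmetric] algebra_simps)
    also have "\<dots> = x ^ j"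
      using x_pos by (simp add: w_def exp_of_nat_mult)
    finally show "exp (m * w) * (1 + (real j - m) * w) \<le> x ^ j" .
  qed
  finally have "exp (m * w) \<le> real n / real r"
    using r_ge_1 unfolding sum_eq by (simp add: field_simps)
  then have "m * w \<le> ln (real n / real r)"
    using r_ge_1 n_pos by (simp add: ln_ge_iff)
  then show ?thesis
    using w by (simp add: m_def w_def field_simps)
qed

lemma square_ge_of_minor_arc:
  assumes "pi / real r < \<bar>t\<bar>"
  shows "9 / (real r)\<^sup>2 \<le> t\<^sup>2"
proof -
  have "3 / real r \<le> \<bar>t\<bar>"
    using assms pi_gt3 r_ge_1 by (smt (verit) divide_right_mono of_nat_0_le_iff)
  then have "(3 / real r)\<^sup>2 \<le> \<bar>t\<bar>\<^sup>2"
    by (intro power_mono) auto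
  then show ?thesis by (simp add: power_divide)
qed

text \<open>The angles of the terms \<open>j = r - 1\<close> and \<open>j = r\<close> differ by
  \<open>t\<close>, so their cosines cannot both be near 1: \<open>1 - cos t\<close> is at least
  \<open>t^2 / 12\<close>, hence at least \<open>3 / (4 r^2)\<close>. Both weights are large because
  the sum is essentially geometric with ratio at least 2.\<close>

lemma minor_arc_large_x:
  assumes x: "2 \<le> x" and t: "pi / real r < \<bar>t\<bar>" "\<bar>t\<bar> \<le> pi"
  shows "sqrt (real n / 2) / (3 * (log 2 (real n)) ^ 3) \<le> - Re (phase t)"
proof -
  \<comment> \<open>For \<open>r = 1\<close> the minor arcs are empty.\<close>
  have r: "2 \<le> r"
  proof (rule ccontr)
    assume "\<not> 2 \<le> r"
    then have "r = 1" using r_ge_1 by simp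
    then show False using t by simp
  qed
  have "x / 2 * real n \<le> (x - 1) * real n"
    using x by (intro mult_right_mono) auto
  also have "\<dots> \<le> x * x ^ r"
    using geometric_sum_from_1[of x r] x_pos unfolding sum_eq by simp
  finally have n: "real n / 2 \<le> x ^ r"
    using x_pos by simp
  \<comment> \<open>\<open>r \<le> 2 (r - 1)\<close>; the square root of \<open>n / 2\<close> thus
    bounds the smaller of the two top powers.\<close>
  also have "x ^ r \<le> (x ^ (r - 1))\<^sup>2"
    unfolding power_mult[symmetric] using r x_ge_1 by (intro power_increasing) auto
  finally have sq: "sqrt (real n / 2) \<le> x ^ (r - 1)"
    using x_pos by (intro real_le_lsqrt) auto
  have "2 ^ r \<le> x ^ r" using x by (intro power_mono) auto
  then have "2 ^ r \<le> real n" using power_le_n by (rule order_trans)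
  then have "2 powr real r \<le> real n" by (simp add: powr_realpow)
  then have rlog: "real r \<le> log 2 (real n)"
    using n_pos by (simp add: le_log_iff)
  have "sqrt (real n / 2) / (3 * (log 2 (real n)) ^ 3) \<le> x ^ (r - 1) / (3 * real r ^ 3)"
    using sq rlog r x_pos by (intro frac_le mult_left_mono power_mono) auto
  also have "\<dots> \<le> x ^ (r - 1) / real r * (3 / 8 / (real r)\<^sup>2)"
    using x_pos r by (simp add: field_simps eval_nat_numeral)
  also have "\<dots> \<le> x ^ (r - 1) / real r * (1 / 2 * (1 - cos t))"
    using square_ge_of_minor_arc[OF t(1)] cos_quadratic_bounds(2)[OF t(2)] x_pos
    by (intro mult_left_mono) auto
  also have "\<dots> \<le> x ^ (r - 1) / real r * ((1 - cos (real (r - 1) * t)) + (1 - cos (real r * t)))"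
  proof -
    have "real r * t - real (r - 1) * t = t"
      using r by (simp add: of_nat_diff algebra_simps)
    then have "1 - cos t \<le> 2 * (1 - cos (real r * t)) + 2 * (1 - cos (real (r - 1) * t))"
      using one_minus_cos_diff_le[of "real r * t" "real (r - 1) * t"] by simp
    then show ?thesis using x_pos by (intro mult_left_mono) auto
  qed
  also have "\<dots> \<le> x ^ (r - 1) / real (r - 1) * (1 - cos (real (r - 1) * t)) + x ^ r / real r * (1 - cos (real r * t))"
    unfolding distrib_left using r x_ge_1
    by (intro add_mono mult_right_mono divide_left_mono divide_right_mono power_increasing) auto
  also have "\<dots> = (\<Sum>j\<in>{r - 1, r}. x ^ j / real j * (1 - cos (real j * t)))"
    using r by simp
  also have "\<dots> \<le> - Re (phase t)"
    unfolding Re_phase minus_minus using r x_pos by (intro sum_mono2) auto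
  finally show ?thesis .
qed

text \<open>Compare \<open>cmod S\<close>, at most \<open>x (A + 1) / cmod (z - 1)\<close>, with
  \<open>n = x (A - 1) / (x - 1)\<close>. The denominator gains \<open>1 + d / 4\<close> and the
  numerator loses at most \<open>1 + d / 8\<close>, so \<open>n - Re S\<close> is at least
  \<open>n d / 10\<close>. Replacing the weights \<open>1 / j\<close> by \<open>1 / r\<close> then
  gives \<open>u d / 10\<close>.\<close>

lemma minor_arc_small_x:
  assumes x: "x < 2" and t: "pi / real r < \<bar>t\<bar>" "\<bar>t\<bar> \<le> pi"
    and u: "u = real n / real r" "1 < u" "1 \<le> ln u" "2 / (u - 1) \<le> 1 / (64 * (ln u)\<^sup>2)"
  shows "u / (80 * (ln u)\<^sup>2) \<le> - Re (phase t)"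
proof -
  \<comment> \<open>Chosen so that \<open>(x - 1)^2 d \<le> x / r^2\<close>, which follows from
    \<open>r (x - 1) \<le> 2 x ln u\<close> and \<open>x < 2\<close>.\<close>
  define d where "d = 1 / (8 * (ln u)\<^sup>2)"
  define z where "z = of_real x * cis t"
  define S where "S = (\<Sum>j=1..r. z ^ j)"
  define A where "A = x ^ r"
  have "1 \<le> (ln u)\<^sup>2" using u(3) by simp
  then have "1 \<le> 8 * (ln u)\<^sup>2" by linarith
  then have d: "0 < d" "d \<le> 1" using u(3) by (auto simp: d_def)
  have d2: "2 / (u - 1) \<le> d / 8" using u(4) by (simp add: d_def)
  have x1: "1 < x"
  proof (rule ccontr)
    assume "\<not> 1 < x"
    then have "x = 1" using x_ge_1 by simp
    then show False using sum_eq u r_ge_1 by simp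
  qed
  have uA: "u \<le> A"
    using n_le_power r_ge_1 by (simp add: u(1) A_def field_simps)
  have "x - 1 \<le> x * ln x"
    using ln_le_minus_one[of "1 / x"] x_pos by (simp add: ln_div field_simps)
  then have "real r * (x - 1) \<le> x * (real r * ln x)"
    using mult_left_mono[of "x - 1" "x * ln x" "real r"] by (simp add: mult_ac)
  also have "\<dots> \<le> x * (2 * ln u)"
    using r_ln_x_le x_pos unfolding u(1) by (intro mult_left_mono) auto
  finally have "(real r * (x - 1))\<^sup>2 \<le> (x * (2 * ln u))\<^sup>2"
    using x1 by (intro power_mono) auto
  also have "\<dots> = x * x * (4 * (ln u)\<^sup>2)"
    by (simp add: power2_eq_square)
  also have "\<dots> \<le> 2 * x * (4 * (ln u)\<^sup>2)"
    using x x_pos by (intro mult_right_mono) auto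
  finally have "(real r)\<^sup>2 * (x - 1)\<^sup>2 \<le> x * (8 * (ln u)\<^sup>2)"
    unfolding power_mult_distrib by simp
  then have *: "(x - 1)\<^sup>2 * d \<le> x / (real r)\<^sup>2"
    using u(3) r_ge_1 by (simp add: d_def divide_simps mult_ac)
  \<comment> \<open>The squared modulus of \<open>z - 1\<close> is
    \<open>(x - 1)^2 + 2 x (1 - cos t)\<close>, and on the minor arcs the last term is at least
    \<open>x / r^2\<close>.\<close>
  have "((x - 1) * (1 + d / 4))\<^sup>2 \<le> (x - 1)\<^sup>2 * (1 + d)"
    unfolding power_mult_distrib
  proof (rule mult_left_mono)
    have "d * d \<le> d * 1" using d by (intro mult_left_mono) auto
    moreover have "(1 + d / 4)\<^sup>2 = 1 + d / 2 + d * d / 16"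
      by (simp add: power2_eq_square algebra_simps)
    ultimately show "(1 + d / 4)\<^sup>2 \<le> 1 + d"
      using d by linarith
  qed simp
  also have "\<dots> \<le> (x - 1)\<^sup>2 + x / (real r)\<^sup>2"
    using * by (simp add: algebra_simps)
  also have "\<dots> \<le> (x - 1)\<^sup>2 + 2 * x * (1 - cos t)"
  proof -
    have "9 * (1 / (real r)\<^sup>2) \<le> 12 * (1 - cos t)"
      using square_ge_of_minor_arc[OF t(1)] cos_quadratic_bounds(2)[OF t(2)] by simp
    moreover have "0 \<le> 1 / (real r)\<^sup>2" by simp
    ultimately have "1 / (real r)\<^sup>2 \<le> 2 * (1 - cos t)" by argo
    from mult_left_mono[OF this, of x] show ?thesis using x_pos by (simp add: algebra_simps)
  qed
  also have "\<dots> = (x * cos t - 1)\<^sup>2 + (x * sin t)\<^sup>2"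
    using sin_cos_squared_add[of t] by algebra
  also have "\<dots> = (cmod (z - 1))\<^sup>2"
    by (simp add: z_def cmod_power2)
  finally have z: "(x - 1) * (1 + d / 4) \<le> cmod (z - 1)"
    by (rule power2_le_imp_le) simp
  have "(x - 1) * ((1 + d / 4) * cmod S) \<le> cmod (z - 1) * cmod S"
    unfolding mult.assoc[symmetric] using z by (intro mult_right_mono) auto
  also have "\<dots> = cmod (z ^ Suc r - z)"
    unfolding S_def norm_mult[symmetric] geometric_sum_from_1 ..
  also have "\<dots> \<le> x * (A + 1)"
    using norm_triangle_ineq4[of "z ^ Suc r" z] x_pos
    by (simp add: z_def A_def norm_mult norm_power algebra_simps)
  also have "\<dots> = x * (A - 1) * (1 + 2 / (A - 1))"
    using uA u(2) by (simp add: field_simps)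
  also have "\<dots> \<le> x * (A - 1) * (1 + d / 8)"
  proof -
    have "2 / (A - 1) \<le> 2 / (u - 1)" using uA u(2) by (intro divide_left_mono) auto
    then show ?thesis using d2 uA u(2) x_pos by (intro mult_left_mono) auto
  qed
  also have "x * (A - 1) = (x - 1) * real n"
    using geometric_sum_from_1[of x r] unfolding sum_eq A_def by (simp add: algebra_simps)
  finally have "(1 + d / 4) * cmod S \<le> real n * (1 + d / 8)"
    using x1 by (simp add: mult.assoc)
  \<comment> \<open>The product is \<open>1 + 3 d / 20 - d^2 / 40\<close>, which is at least
    \<open>1 + d / 8\<close> because \<open>d \<le> 1\<close>.\<close>
  also have "\<dots> \<le> real n * ((1 + d / 4) * (1 - d / 10))"
  proof -
    have "d * d \<le> d * 1" using d by (intro mult_left_mono) auto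
    then show ?thesis by (intro mult_left_mono) (auto simp: algebra_simps)
  qed
  finally have "(1 + d / 4) * cmod S \<le> (1 + d / 4) * (real n * (1 - d / 10))"
    by (simp add: mult_ac)
  then have S: "cmod S \<le> real n * (1 - d / 10)"
    using d by (simp add: mult_le_cancel_left)
  have "Re S = (\<Sum>j=1..r. x ^ j * cos (real j * t))"
    by (simp add: S_def z_def power_mult_distrib Complex.DeMoivre of_real_power[symmetric] del: of_real_power)
  then have "real n - Re S = (\<Sum>j=1..r. x ^ j * (1 - cos (real j * t)))"
    unfolding sum_eq[symmetric] by (simp add: sum_subtractf right_diff_distrib)
  moreover have "real n * (d / 10) \<le> real n - Re S"
    using S complex_Re_le_cmod[of S] by (simp add: algebra_simps)
  ultimately have "real n * (d / 10) / real r \<le> (\<Sum>j=1..r. x ^ j * (1 - cos (real j * t))) / real r"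
    by (intro divide_right_mono) auto
  also have "\<dots> \<le> - Re (phase t)"
    unfolding Re_phase minus_minus sum_divide_distrib
  proof (rule sum_mono)
    fix j assume "j \<in> {1..r}"
    then show "x ^ j * (1 - cos (real j * t)) / real r \<le> x ^ j / real j * (1 - cos (real j * t))"
      using x_pos by (simp only: times_divide_eq_left) (intro divide_left_mono mult_nonneg_nonneg, auto)
  qed
  finally show ?thesis by (simp add: u(1) d_def mult_ac)
qed

end

section \<open>The integral of the phase\<close>

lemma div_ln_square_mono:
  fixes u v :: real
  assumes "2 \<le> ln u" "0 < u" "u \<le> v"
  shows "u / (ln u)\<^sup>2 \<le> v / (ln v)\<^sup>2"
proof -
  \<comment> \<open>The square root makes \<open>ln v = ln u + 2 ln s\<close>; then
    \<open>ln s \<le> s - 1\<close> and \<open>2 \<le> ln u\<close> give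
    \<open>ln v \<le> s ln u\<close> without derivatives.\<close>
  define s where "s = sqrt (v / u)"
  have s: "1 \<le> s" "s\<^sup>2 = v / u"
    using assms by (auto simp: s_def)
  have v: "v = u * s\<^sup>2" using s assms by simp
  have "ln v = ln u + 2 * ln s"
    unfolding v using assms(2) s(1) by (simp add: ln_mult ln_realpow)
  also have "\<dots> \<le> ln u + 2 * (s - 1)"
    using s ln_le_minus_one[of s] by simp
  also have "\<dots> \<le> ln u + ln u * (s - 1)"
    using s assms by (intro add_left_mono mult_right_mono) auto
  finally have "ln v \<le> s * ln u" by (simp add: algebra_simps)
  moreover have "2 \<le> ln v" using assms by (smt (verit) ln_le_cancel_iff)
  ultimately have "(ln v)\<^sup>2 \<le> s\<^sup>2 * (ln u)\<^sup>2"
    unfolding power_mult_distrib[symmetric] by (intro power_mono) auto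
  then have "u * (ln v)\<^sup>2 \<le> v * (ln u)\<^sup>2"
    unfolding v using assms(2) by (simp add: mult.assoc)
  moreover have "0 < (ln u)\<^sup>2" "0 < (ln v)\<^sup>2"
    using \<open>2 \<le> ln v\<close> assms(1) by simp_all
  ultimately show ?thesis
    using divide_le_eq[of u "(ln u)\<^sup>2" "v / (ln v)\<^sup>2"] pos_le_divide_eq[of "(ln v)\<^sup>2" u "v * (ln u)\<^sup>2"]
    by simp
qed

text \<open>By monotonicity it suffices to take the least admissible \<open>u\<close>. Its logarithm
  is asymptotic to \<open>ln (ln y)\<close>, so \<open>u / (ln u)^2\<close> is asymptotic to
  \<open>216 ln y\<close>, above the required \<open>2 * 80 * ln y\<close>.\<close>

lemma eventually_minor_arc_parameters:
  "\<forall>\<^sub>F y::real in at_top. \<forall>u. 216 * ln y * (ln (ln y))\<^sup>2 \<le> u \<longrightarrow>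
     1 < u \<and> 1 \<le> ln u \<and> 2 / (u - 1) \<le> 1 / (64 * (ln u)\<^sup>2) \<and> 2 * ln y \<le> u / (80 * (ln u)\<^sup>2)"
proof -
  let ?f = "\<lambda>y::real. 216 * ln y * (ln (ln y))\<^sup>2"
  have "\<forall>\<^sub>F u::real in at_top. 1 < u \<and> 2 \<le> ln u \<and> 2 / (u - 1) \<le> 1 / (64 * (ln u)\<^sup>2)"
    by (intro eventually_conj; real_asymp)
  then obtain U where U: "\<And>u::real. U \<le> u \<Longrightarrow> 1 < u \<and> 2 \<le> ln u \<and> 2 / (u - 1) \<le> 1 / (64 * (ln u)\<^sup>2)"
    by (auto simp: eventually_at_top_linorder)
  have "filterlim ?f at_top at_top" by real_asymp
  then have "\<forall>\<^sub>F y in at_top. U \<le> ?f y" by (auto simp: filterlim_at_top)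
  moreover have "\<forall>\<^sub>F y in at_top. 160 * ln y \<le> ?f y / (ln (?f y))\<^sup>2" by real_asymp
  ultimately show ?thesis
  proof eventually_elim
    case (elim y)
    show ?case
    proof (intro allI impI)
      fix u assume u: "?f y \<le> u"
      have "160 * ln y \<le> u / (ln u)\<^sup>2"
        using elim(2) div_ln_square_mono[OF _ _ u] U[OF elim(1)] by simp
      then have "2 * ln y \<le> u / (80 * (ln u)\<^sup>2)"
        by simp
      moreover note U[of u]
      ultimately show "1 < u \<and> 1 \<le> ln u \<and> 2 / (u - 1) \<le> 1 / (64 * (ln u)\<^sup>2) \<and> 2 * ln y \<le> u / (80 * (ln u)\<^sup>2)"
        using u elim(1) by auto
    qed
  qed
qed

lemma eventually_sqrt_div_log_cube:
  "\<forall>\<^sub>F y::real in at_top. 2 * ln y \<le> sqrt (y / 2) / (3 * (log 2 y) ^ 3)"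
  unfolding log_def by real_asymp

context saddle_eq
begin

lemma phase_integral:
  assumes minor: "\<And>t. pi / real r < \<bar>t\<bar> \<Longrightarrow> \<bar>t\<bar> \<le> pi \<Longrightarrow> 2 * ln (real n) \<le> - Re (phase t)"
  shows "cmod ((\<integral>t. indicator {-pi..pi} t *\<^sub>R exp (phase t) \<partial>lborel) - of_real (sqrt (2 * pi / lam r x)))
    \<le> 200000 * (real r / real n) / sqrt (lam r x)"
proof -
  let ?L = "lam r x"
  let ?a = "pi / real r"
  let ?\<Phi> = "\<lambda>t. indicator {-pi..pi} t *\<^sub>R exp (phase t)"
  let ?g = "\<lambda>t. exp (- (?L / 2 * t\<^sup>2))"
  \<comment> \<open>The cubic correction is cut off to the central arc, where
    \<open>major_arc\<close> uses it; the cut-off is symmetric, so the function stays odd.\<close>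
  let ?o = "\<lambda>t. of_real (?g t) * (indicator {-?a..?a} t *\<^sub>R (\<i> * of_real (third * t ^ 3 / 6)))"
  \<comment> \<open>One majorant for everything: the wide Gaussian covers the error on the central
    arc and the Gaussian tail outside it, and the indicator covers the integrand on the minor
    arcs.\<close>
  let ?h = "\<lambda>t. 20000 * (real r / real n) * exp (- (?L / 24 * t\<^sup>2)) + indicator {-pi..pi} t * (1 / (real n)\<^sup>2)"
  have a: "?a \<le> pi" "0 \<le> ?a" using r_ge_1 by (auto simp: field_simps)
  have [continuous_intros]: "continuous_on A phase" for A
    unfolding phase_def[abs_def] cis_conv_exp by (intro continuous_intros)
  have \<Phi>: "integrable lborel ?\<Phi>"
    using borel_integrable_compact[of "{-pi..pi}" "\<lambda>t. exp (phase t)"] by (auto intro!: continuous_intros)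
  have g: "integrable lborel ?g" "(\<integral>t. ?g t \<partial>lborel) = sqrt (2 * pi / ?L)"
    using gaussian_integral[of "?L / 2"] lam_pos by (auto simp: mult.commute)
  have o: "integrable lborel ?o"
  proof -
    have eq: "?o = (\<lambda>t. indicator {-?a..?a} t *\<^sub>R (of_real (?g t) * (\<i> * of_real (third * t ^ 3 / 6))))"
      by (auto simp: indicator_def)
    show ?thesis unfolding eq
      by (rule borel_integrable_compact) (auto intro!: continuous_intros)
  qed
  have o0: "(\<integral>t. ?o t \<partial>lborel) = 0"
  proof -
    have "(\<integral>t. ?o t \<partial>lborel) = (\<integral>t. ?o (- t) \<partial>lborel)"
      using lborel_integral_real_affine[of "-1" ?o 0] by simp
    also have "\<dots> = (\<integral>t. - ?o t \<partial>lborel)"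
      by (intro Bochner_Integration.integral_cong refl) (auto simp: indicator_def)
    finally show ?thesis by simp
  qed
  have h: "integrable lborel ?h"
    using gaussian_integral(1)[of "?L / 24"] lam_pos by (auto intro!: integrable_real_mult_indicator)
  have eq: "(\<integral>t. ?\<Phi> t \<partial>lborel) - of_real (sqrt (2 * pi / ?L)) = (\<integral>t. ?\<Phi> t - (of_real (?g t) - ?o t) \<partial>lborel)"
    using \<Phi> g o o0 by simp
  have "cmod ((\<integral>t. ?\<Phi> t \<partial>lborel) - of_real (sqrt (2 * pi / ?L))) \<le> (\<integral>t. ?h t \<partial>lborel)"
    unfolding eq
  proof (rule Bochner_Integration.integral_norm_bound_integral)
    show "integrable lborel (\<lambda>t. ?\<Phi> t - (of_real (?g t) - ?o t))" using \<Phi> g o by simp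
    show "integrable lborel ?h" by (rule h)
    fix t :: real
    show "norm (?\<Phi> t - (of_real (?g t) - ?o t)) \<le> ?h t"
    proof (cases "\<bar>t\<bar> \<le> ?a")
      case True
      then have "t \<in> {-?a..?a}" "t \<in> {-pi..pi}" using a by auto
      moreover note major_arc[OF True]
      ultimately show ?thesis by (simp add: algebra_simps add_increasing)
    next
      case False
      then have t: "t \<notin> {-?a..?a}" by auto
      have "norm (?\<Phi> t) \<le> indicator {-pi..pi} t * (1 / (real n)\<^sup>2)"
      proof (cases "t \<in> {-pi..pi}")
        case True
        then have "\<bar>t\<bar> \<le> pi" by auto
        with False have "2 * ln (real n) \<le> - Re (phase t)"
          by (metis minor not_le)
        then have "Re (phase t) \<le> - ln ((real n)\<^sup>2)"
          using n_pos by (simp add: ln_realpow)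
        then have "exp (Re (phase t)) \<le> exp (- ln ((real n)\<^sup>2))" by simp
        also have "\<dots> = 1 / (real n)\<^sup>2"
          using n_pos by (subst exp_minus, subst exp_ln) (simp_all add: divide_inverse)
        finally show ?thesis using True by simp
      qed simp
      moreover have "?g t \<le> 20000 * (real r / real n) * exp (- (?L / 24 * t\<^sup>2))"
      proof -
        have "pi / real r < \<bar>t\<bar>" using False by (rule not_le_imp_less)
        from gaussian_tail[OF this] have "?g t \<le> real r / real n * exp (- (?L / 24 * t\<^sup>2))"
          by (simp only: times_divide_eq_left)
        also have "\<dots> \<le> 20000 * (real r / real n) * exp (- (?L / 24 * t\<^sup>2))"
          by (rule mult_right_mono) (simp_all add: divide_right_mono)
        finally show ?thesis .
      qed
      moreover have "?o t = 0" using t by simp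
      then have "norm (?\<Phi> t - (of_real (?g t) - ?o t)) \<le> norm (?\<Phi> t) + norm (of_real (?g t) :: complex)"
        by (simp only: diff_zero norm_triangle_ineq4)
      moreover have "norm (of_real (?g t) :: complex) = ?g t"
        by (simp only: norm_of_real abs_exp_cancel)
      ultimately show ?thesis by linarith
    qed
  qed
  also have "\<dots> = 20000 * (real r / real n) * sqrt (24 * pi / ?L) + 2 * pi / (real n)\<^sup>2"
  proof -
    have L: "0 < ?L / 24" "pi / (?L / 24) = 24 * pi / ?L" using lam_pos by simp_all
    have "(\<integral>t. indicator {-pi..pi} t * (1 / (real n)\<^sup>2) \<partial>lborel) = 2 * pi / (real n)\<^sup>2"
      by simp
    moreover have "(\<integral>t. 20000 * (real r / real n) * exp (- (?L / 24 * t\<^sup>2)) \<partial>lborel) =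
        20000 * (real r / real n) * sqrt (24 * pi / ?L)"
      by (simp only: integral_mult_right_zero gaussian_integral(2)[OF L(1)] L(2))
    moreover have "integrable lborel (\<lambda>t. 20000 * (real r / real n) * exp (- (?L / 24 * t\<^sup>2)))"
      by (intro integrable_mult_right gaussian_integral(1) L(1))
    moreover have "integrable lborel (\<lambda>t. indicator {-pi..pi} t * (1 / (real n)\<^sup>2))"
      by (intro integrable_mult_left) simp
    ultimately show ?thesis
      by (simp only: Bochner_Integration.integral_add)
  qed
  also have "\<dots> \<le> 20000 * (real r / real n) * (9 / sqrt ?L) + 7 * ((real r / real n) / sqrt ?L)"
  proof (intro add_mono mult_left_mono)
    have "sqrt (24 * pi) \<le> 9"
      using pi_approx by (intro real_le_lsqrt) auto
    then show "sqrt (24 * pi / ?L) \<le> 9 / sqrt ?L"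
      using lam_pos by (simp add: real_sqrt_divide divide_right_mono)
    \<comment> \<open>\<open>lam r x \<le> r n \<le> n^2\<close>, so the contribution of order
      \<open>n^-2\<close> is also at most a multiple of \<open>r / n\<close> over the square root of
      \<open>lam r x\<close>.\<close>
    have "?L \<le> (real n)\<^sup>2"
      using lam_le n_ge_r mult_right_mono[of "real r" "real n" "real n"] by (simp add: power2_eq_square)
    then have "sqrt ?L \<le> real n" by (intro real_le_lsqrt) auto
    moreover have "0 < sqrt ?L" using lam_pos by simp
    ultimately have "1 / (real n)\<^sup>2 \<le> 1 / (real n * sqrt ?L)"
      using n_pos unfolding power2_eq_square by (intro divide_left_mono mult_left_mono) auto
    also have "\<dots> \<le> (real r / real n) / sqrt ?L"
      using r_ge_1 lam_pos n_pos by (simp add: divide_right_mono)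
    finally have "1 / (real n)\<^sup>2 \<le> (real r / real n) / sqrt ?L" .
    then have "2 * pi * (1 / (real n)\<^sup>2) \<le> 7 * ((real r / real n) / sqrt ?L)"
      using pi_approx by (intro mult_mono) auto
    then show "2 * pi / (real n)\<^sup>2 \<le> 7 * ((real r / real n) / sqrt ?L)" by simp
  qed auto
  also have "\<dots> \<le> 200000 * (real r / real n) / sqrt ?L"
    using lam_pos by (simp add: divide_right_mono)
  finally show ?thesis .
qed

end

section \<open>The saddle point approximation\<close>

lemma saddle_eq_saddle:
  assumes "1 \<le> r" "r \<le> n"
  shows "saddle_eq r n (saddle r (real n / real r))"
proof
  let ?x = "saddle r (real n / real r)"
  have "?x > 0 \<and> (\<Sum>j=1..r. ?x ^ j) = real n / real r * real r"
    unfolding saddle_def by (rule theI'[OF saddle_ex1]) (use assms in simp_all)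
  then have x: "?x > 0" "(\<Sum>j=1..r. ?x ^ j) = real n"
    using assms by auto
  show "1 \<le> ?x"
  proof (rule ccontr)
    assume "\<not> 1 \<le> ?x"
    then have "(\<Sum>j=1..r. ?x ^ j) < (\<Sum>j=1..r. 1)"
      using x(1) assms(1) by (intro sum_strict_mono) (auto simp: power_less_one_iff)
    then show False using x(2) assms(2) by simp
  qed
  show "(\<Sum>j=1..r. ?x ^ j) = real n" by (rule x(2))
  show "1 \<le> r" by (rule assms(1))
qed

context saddle_eq
begin

lemma Q_pos: "0 < Q n r x"
  using x_pos by (simp add: Q_def)

lemma prob_eq_phase_integral:
  assumes "indep_poisson_seq M Z"
  shows "of_real (2 * pi * measure M {\<omega> \<in> space M. ell r Z \<omega> = n} / Q n r x) =
    (\<integral>t. indicator {-pi..pi} t *\<^sub>R exp (phase t) \<partial>lborel)"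
proof -
  define E where "E = exp (\<Sum>j=1..r. (x ^ j - 1) / real j)"
  have E: "E \<noteq> 0" "Q n r x = E / x ^ n" by (simp_all add: E_def Q_def)
  have "exp (\<Sum>j=1..r. ((of_real x * cis t) ^ j - 1) / of_nat j) * cis (- (real n * t)) = of_real E * exp (phase t)" for t
  proof -
    have "(\<Sum>j=1..r. ((of_real x * cis t) ^ j - 1) / of_nat j) =
        of_real (\<Sum>j=1..r. (x ^ j - 1) / real j) + (\<Sum>j=1..r. of_real (x ^ j / real j) * (cis (real j * t) - 1))"
      unfolding of_real_sum sum.distrib[symmetric]
      by (intro sum.cong refl) (simp add: power_mult_distrib Complex.DeMoivre field_simps)
    then show ?thesis
      by (simp add: E_def phase_def exp_of_real[symmetric] exp_add exp_diff cis_conv_exp exp_minus field_simps)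
  qed
  then have "of_real (2 * pi * x ^ n * measure M {\<omega> \<in> space M. ell r Z \<omega> = n}) =
      (\<integral>t. of_real E * (indicator {-pi..pi} t *\<^sub>R exp (phase t)) \<partial>lborel)"
    unfolding ell_coefficient[OF assms x_pos] by simp
  also have "\<dots> = of_real E * (\<integral>t. indicator {-pi..pi} t *\<^sub>R exp (phase t) \<partial>lborel)"
    by (rule integral_mult_right_zero)
  finally show ?thesis
    using E by (simp add: field_simps)
qed

text \<open>Multiplying the integral by the square root of \<open>lam r x / (2 pi)\<close> turns the
  absolute error into a relative one, and \<open>lam r x\<close> cancels from the bound.\<close>

lemma saddle_approximation:
  assumes "indep_poisson_seq M Z"
    and minor: "\<And>t. pi / real r < \<bar>t\<bar> \<Longrightarrow> \<bar>t\<bar> \<le> pi \<Longrightarrow> 2 * ln (real n) \<le> - Re (phase t)"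
  shows "\<bar>measure M {\<omega> \<in> space M. ell r Z \<omega> = n} / (Q n r x / sqrt (2 * pi * lam r x)) - 1\<bar> \<le> 200000 * real r / real n"
proof -
  define J where "J = 2 * pi * measure M {\<omega> \<in> space M. ell r Z \<omega> = n} / Q n r x"
  let ?L = "lam r x"
  have "cmod (of_real J - of_real (sqrt (2 * pi / ?L))) \<le> 200000 * (real r / real n) / sqrt ?L"
    unfolding J_def prob_eq_phase_integral[OF assms(1)] by (rule phase_integral[OF minor])
  then have J: "\<bar>J - sqrt (2 * pi / ?L)\<bar> \<le> 200000 * (real r / real n) / sqrt ?L"
    by (simp only: of_real_diff[symmetric] norm_of_real)
  have L: "sqrt ?L > 0" using lam_pos by simp
  have s: "sqrt (2 * pi) > 1" using pi_gt3 by simp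
  have "measure M {\<omega> \<in> space M. ell r Z \<omega> = n} / (Q n r x / sqrt (2 * pi * ?L)) = J * sqrt (2 * pi * ?L) / (2 * pi)"
    by (simp add: J_def)
  also have "\<dots> = J * sqrt ?L / sqrt (2 * pi)"
    using s by (simp add: real_sqrt_mult field_simps flip: power2_eq_square)
  finally have e: "measure M {\<omega> \<in> space M. ell r Z \<omega> = n} / (Q n r x / sqrt (2 * pi * ?L)) = J * (sqrt ?L / sqrt (2 * pi))"
    by simp
  have "sqrt (2 * pi / ?L) * (sqrt ?L / sqrt (2 * pi)) = 1"
    using L s by (simp add: real_sqrt_divide)
  then have eq: "measure M {\<omega> \<in> space M. ell r Z \<omega> = n} / (Q n r x / sqrt (2 * pi * ?L)) - 1 =
      (J - sqrt (2 * pi / ?L)) * (sqrt ?L / sqrt (2 * pi))"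
    unfolding e left_diff_distrib by (simp only:)
  have "sqrt ?L / sqrt (2 * pi) \<le> sqrt ?L / 1"
    by (rule divide_left_mono) (use s L in simp_all)
  then have "\<bar>(J - sqrt (2 * pi / ?L)) * (sqrt ?L / sqrt (2 * pi))\<bar> \<le> 200000 * (real r / real n) / sqrt ?L * (sqrt ?L / 1)"
    unfolding abs_mult using s L by (intro mult_mono J) (simp_all add: abs_of_pos)
  also have "\<dots> = 200000 * real r / real n"
    using L by simp
  finally show ?thesis unfolding eq .
qed

end

section \<open>Consequences of the upper bound on \<open>r\<close>\<close>

lemma ln_ln_lower_bounds:
  fixes y :: real
  assumes "4 \<le> y"
  shows "4 / 3 \<le> ln y" and "1 / 4 \<le> ln (ln y)"
proof -
  have "ln (4::real) = 2 * ln 2"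
    using ln_realpow[of 2 2] by simp
  then have "4 / 3 \<le> ln (4::real)" using ln2_ge_two_thirds by simp
  also have "ln 4 \<le> ln y" using assms by simp
  finally show 1: "4 / 3 \<le> ln y" .
  have "ln (3 / 4 :: real) \<le> 3 / 4 - 1" by (rule ln_le_minus_one) simp
  then have "1 / 4 \<le> ln (4 / 3 :: real)" by (simp add: ln_div)
  also have "\<dots> \<le> ln (ln y)" using 1 by simp
  finally show "1 / 4 \<le> ln (ln y)" .
qed

text \<open>From \<open>pi > 3\<close> and \<open>exp 1 \<ge> 2\<close> the constant
  \<open>12 pi^2 e\<close> is at least \<open>12 * 9 * 2 = 216\<close>. Already from
  \<open>n = 4\<close> on, \<open>D \<ge> 1/12\<close>, so \<open>n / r\<close> is at least 18 and
  \<open>r \<le> n\<close> follows.\<close>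

lemma r_bound_imp_ratio_bound:
  fixes n r :: nat
  assumes "4 \<le> n" "1 \<le> r"
    and r: "real r \<le> 1 / (12 * pi\<^sup>2 * exp 1) * real n * inverse (ln (real n)) * inverse ((ln (ln (real n)))\<^sup>2)"
  shows "216 * ln (real n) * (ln (ln (real n)))\<^sup>2 \<le> real n / real r" and "r \<le> n"
proof -
  have ln: "4 / 3 \<le> ln (real n)" "1 / 4 \<le> ln (ln (real n))"
    using ln_ln_lower_bounds[of "real n"] assms(1) by auto
  define D where "D = ln (real n) * (ln (ln (real n)))\<^sup>2"
  have "4 / 3 * (1 / 4)\<^sup>2 \<le> D"
    unfolding D_def using ln by (intro mult_mono power_mono) auto
  then have D: "1 / 12 \<le> D" by (simp add: power2_eq_square)
  have "3\<^sup>2 \<le> pi\<^sup>2" using pi_gt3 by (intro power_mono) auto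
  then have "12 * 9 * 2 \<le> 12 * pi\<^sup>2 * exp 1"
    using exp_ge_add_one_self[of 1] by (intro mult_mono) auto
  then have "1 / (12 * pi\<^sup>2 * exp 1) \<le> 1 / 216"
    by (intro divide_left_mono) auto
  then have "1 / (12 * pi\<^sup>2 * exp 1) * (real n / D) \<le> 1 / 216 * (real n / D)"
    using D by (intro mult_right_mono) auto
  then have "real r \<le> 1 / 216 * (real n / D)"
    using r unfolding D_def divide_inverse inverse_mult_distrib
    by (simp only: mult.assoc)
  then have *: "216 * D \<le> real n / real r"
    using D assms(2) by (simp add: field_simps)
  then show "216 * ln (real n) * (ln (ln (real n)))\<^sup>2 \<le> real n / real r"
    by (simp add: D_def)
  have "1 \<le> real n / real r" using * D by simp
  then show "r \<le> n" using assms(2) by simp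
qed

theorem theorem2:
  shows "\<exists>C::real. C > 0 \<and>
    (\<forall>(M :: 'a measure) (Z :: nat \<Rightarrow> 'a \<Rightarrow> nat) (n::nat) (r::nat).
      indep_poisson_seq M Z \<longrightarrow> n \<ge> 4 \<longrightarrow> r \<ge> 1 \<longrightarrow>
      real r \<le> 1 / (12 * pi\<^sup>2 * exp 1) *
                real n * inverse (ln (real n)) * inverse ((ln (ln (real n)))\<^sup>2) \<longrightarrow>
      (let x = saddle r (real n / real r) in
        \<exists>\<epsilon>::real.
          measure M {\<omega> \<in> space M. ell r Z \<omega> = n}
            = Q n r x / sqrt (2 * pi * lam r x) * (1 + \<epsilon>) \<and>
          \<bar>\<epsilon>\<bar> \<le> C * real r / real n))"
proof -
  define main where "main n r = Q n r (saddle r (real n / real r)) / sqrt (2 * pi * lam r (saddle r (real n / real r)))" for n r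
  have "\<forall>\<^sub>F y::real in at_top. (\<forall>u. 216 * ln y * (ln (ln y))\<^sup>2 \<le> u \<longrightarrow>
      1 < u \<and> 1 \<le> ln u \<and> 2 / (u - 1) \<le> 1 / (64 * (ln u)\<^sup>2) \<and> 2 * ln y \<le> u / (80 * (ln u)\<^sup>2)) \<and>
      2 * ln y \<le> sqrt (y / 2) / (3 * (log 2 y) ^ 3)"
    by (intro eventually_conj eventually_minor_arc_parameters eventually_sqrt_div_log_cube)
  then obtain Y where Y: "\<And>y u::real. Y \<le> y \<Longrightarrow> 216 * ln y * (ln (ln y))\<^sup>2 \<le> u \<Longrightarrow>
      1 < u \<and> 1 \<le> ln u \<and> 2 / (u - 1) \<le> 1 / (64 * (ln u)\<^sup>2) \<and> 2 * ln y \<le> u / (80 * (ln u)\<^sup>2)"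
      "\<And>y. Y \<le> y \<Longrightarrow> 2 * ln y \<le> sqrt (y / 2) / (3 * (log 2 y) ^ 3)"
    by (auto simp: eventually_at_top_linorder)
  define N where "N = nat \<lceil>Y\<rceil>"
  \<comment> \<open>The sum covers the finitely many pairs with \<open>n < N\<close>, where the
    relative error is at most \<open>1 + 1 / main n r\<close> and \<open>r / n\<close> is at least
    \<open>1 / N\<close>. It depends on neither \<open>M\<close> nor \<open>Z\<close>; the absolute
    value keeps every summand nonnegative.\<close>
  define C where "C = 200000 + (\<Sum>n<N. \<Sum>r\<le>n. real N * (1 + 1 / \<bar>main n r\<bar>))"
  have C_ge: "200000 \<le> C"
    unfolding C_def by (intro le_add_same_cancel1[THEN iffD2] sum_nonneg) auto
  have "\<bar>measure M {\<omega> \<in> space M. ell r Z \<omega> = n} / main n r - 1\<bar> \<le> C * real r / real n \<and> 0 < main n r"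
    if Z: "indep_poisson_seq M Z" and n: "4 \<le> n" and r: "1 \<le> r"
      and rn: "real r \<le> 1 / (12 * pi\<^sup>2 * exp 1) * real n * inverse (ln (real n)) * inverse ((ln (ln (real n)))\<^sup>2)"
    for M :: "'a measure" and Z n r
  proof -
    define x where "x = saddle r (real n / real r)"
    note ratio = r_bound_imp_ratio_bound[OF n r rn]
    interpret saddle_eq r n x
      unfolding x_def by (rule saddle_eq_saddle[OF r ratio(2)])
    have main: "main n r = Q n r x / sqrt (2 * pi * lam r x)"
      by (simp add: main_def x_def)
    have main_pos: "0 < main n r"
      unfolding main using Q_pos lam_pos by simp
    have "\<bar>measure M {\<omega> \<in> space M. ell r Z \<omega> = n} / main n r - 1\<bar> \<le> C * real r / real n"
    proof (cases "Y \<le> real n")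
      case True
      note u = Y(1)[OF True ratio(1)]
      have "2 * ln (real n) \<le> - Re (phase t)" if t: "pi / real r < \<bar>t\<bar>" "\<bar>t\<bar> \<le> pi" for t
      proof (cases "2 \<le> x")
        case True
        then show ?thesis
          using minor_arc_large_x[OF _ t] Y(2)[OF \<open>Y \<le> real n\<close>] by linarith
      next
        case False
        then show ?thesis
          using minor_arc_small_x[OF _ t refl] u by (smt (verit))
      qed
      from saddle_approximation[OF Z this]
      have "\<bar>measure M {\<omega> \<in> space M. ell r Z \<omega> = n} / main n r - 1\<bar> \<le> 200000 * real r / real n"
        unfolding main .
      also have "\<dots> \<le> C * real r / real n"
        using C_ge by (intro divide_right_mono mult_right_mono) auto
      finally show ?thesis .
    next
      case False
      then have nN: "n < N" by (simp add: N_def) linarith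
      interpret prob_space M using Z by (simp add: indep_poisson_seq_def)
      \<comment> \<open>For small \<open>n\<close> it is enough that a probability lies in
        \<open>[0, 1]\<close>.\<close>
      have "0 \<le> measure M {\<omega> \<in> space M. ell r Z \<omega> = n} / main n r"
        "measure M {\<omega> \<in> space M. ell r Z \<omega> = n} / main n r \<le> 1 / main n r"
        using main_pos by (auto intro!: divide_right_mono)
      then have "\<bar>measure M {\<omega> \<in> space M. ell r Z \<omega> = n} / main n r - 1\<bar> \<le> 1 + 1 / \<bar>main n r\<bar>"
        using main_pos by linarith
      moreover have "real N * (1 + 1 / \<bar>main n r\<bar>) \<le> C"
      proof -
        have "real N * (1 + 1 / \<bar>main n r\<bar>) \<le> (\<Sum>r\<le>n. real N * (1 + 1 / \<bar>main n r\<bar>))"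
          using ratio(2) by (intro member_le_sum) auto
        also have "\<dots> \<le> (\<Sum>n<N. \<Sum>r\<le>n. real N * (1 + 1 / \<bar>main n r\<bar>))"
          using nN by (intro member_le_sum[where f = "\<lambda>n. \<Sum>r\<le>n. real N * (1 + 1 / \<bar>main n r\<bar>)"] sum_nonneg) auto
        finally show ?thesis by (simp add: C_def)
      qed
      moreover have "C * 1 \<le> C * real r"
        using r C_ge by (intro mult_left_mono) auto
      ultimately have "real N * \<bar>measure M {\<omega> \<in> space M. ell r Z \<omega> = n} / main n r - 1\<bar> \<le> C * real r"
        by (smt (verit) mult_left_mono of_nat_0_le_iff)
      then have "real n * \<bar>measure M {\<omega> \<in> space M. ell r Z \<omega> = n} / main n r - 1\<bar> \<le> C * real r"
        using nN mult_right_mono[of "real n" "real N" "\<bar>measure M {\<omega> \<in> space M. ell r Z \<omega> = n} / main n r - 1\<bar>"]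
        by simp
      then show ?thesis using n_pos by (simp add: field_simps)
    qed
    with main_pos show ?thesis by blast
  qed
  note key = this
  show ?thesis
  proof (intro exI[of _ C] conjI allI impI)
    show "C > 0" using C_ge by simp
    fix M :: "'a measure" and Z n r
    assume "indep_poisson_seq M Z" "4 \<le> n" "1 \<le> r"
      "real r \<le> 1 / (12 * pi\<^sup>2 * exp 1) * real n * inverse (ln (real n)) * inverse ((ln (ln (real n)))\<^sup>2)"
    from key[OF this] have k: "\<bar>measure M {\<omega> \<in> space M. ell r Z \<omega> = n} / main n r - 1\<bar> \<le> C * real r / real n"
        "main n r \<noteq> 0"
      by auto
    have "measure M {\<omega> \<in> space M. ell r Z \<omega> = n} =
        main n r * (1 + (measure M {\<omega> \<in> space M. ell r Z \<omega> = n} / main n r - 1))"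
      using k(2) by simp
    with k(1) show "let x = saddle r (real n / real r) in
        \<exists>\<epsilon>::real.
          measure M {\<omega> \<in> space M. ell r Z \<omega> = n}
            = Q n r x / sqrt (2 * pi * lam r x) * (1 + \<epsilon>) \<and>
          \<bar>\<epsilon>\<bar> \<le> C * real r / real n"
      unfolding main_def Let_def by blast
  qed
qed

end
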